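(* Every (finite) tree is $7$-cordial. That is, for every finite tree $T$ there is a function $f: V(T) \to \mathbb{Z}_7$ such that, defining the weight of each edge $uv$ as $f(uv) = f(u) + f(v) \pmod 7$ and letting $v_a$ (resp. $e_a$) denote the number of vertices (resp. edges) with label (resp. weight) $a$, we have $|v_a - v_b| \le 1$ and $|e_a - e_b| \le 1$ for all $a, b \in \mathbb{Z}_7$.
   Context: All graphs are finite and simple. For an integer $k>0$, a $k$-cordial labeling of a tree $T$ is a map $f:V(T)\to\mathbb{Z}_k$, inducing edge weights $f(uv)=f(u)+f(v) \pmod k$, such that each label appears on at most one more vertex than any other label and each weight appears on at most one more edge than any other weight. A tree is $k$-cordial if it admits a $k$-cordial labeling. *)

theory Defs
  imports Main
begin

text \<open>
  A graph is given by its vertex set and its set of edges, an edge being the two-element set of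
  its end points. The notion of tree in the AFP entry on graph theory is not used here: there the
  closed walk \<open>u, v, u\<close> counts as a cycle of a symmetric digraph.
\<close>

definition simple_graph :: "'a set \<Rightarrow> 'a set set \<Rightarrow> bool" where
  "simple_graph V E \<longleftrightarrow> finite V \<and> (\<forall>e\<in>E. e \<subseteq> V \<and> card e = 2)"

definition is_walk :: "'a set \<Rightarrow> 'a set set \<Rightarrow> 'a list \<Rightarrow> bool" where
  "is_walk V E p \<longleftrightarrow> p \<noteq> [] \<and> set p \<subseteq> V \<and> successively (\<lambda>u v. {u, v} \<in> E) p"

definition connected_graph :: "'a set \<Rightarrow> 'a set set \<Rightarrow> bool" where
  "connected_graph V E \<longleftrightarrow>
     V \<noteq> {} \<and> (\<forall>u\<in>V. \<forall>v\<in>V. \<exists>p. is_walk V E p \<and> hd p = u \<and> last p = v)"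

text \<open>A cycle is listed without repeating its initial vertex at the end.\<close>

definition is_cycle :: "'a set \<Rightarrow> 'a set set \<Rightarrow> 'a list \<Rightarrow> bool" where
  "is_cycle V E p \<longleftrightarrow>
     is_walk V E p \<and> distinct p \<and> 3 \<le> length p \<and> {last p, hd p} \<in> E"

definition is_tree :: "'a set \<Rightarrow> 'a set set \<Rightarrow> bool" where
  "is_tree V E \<longleftrightarrow> simple_graph V E \<and> connected_graph V E \<and> (\<nexists>p. is_cycle V E p)"

text \<open>The elements of $\mathbb{Z}_k$ are represented by the natural numbers below \<open>k\<close>.\<close>

definition edge_weight :: "nat \<Rightarrow> ('a \<Rightarrow> nat) \<Rightarrow> 'a set \<Rightarrow> nat" where
  "edge_weight k f e = (\<Sum>v\<in>e. f v) mod k"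

lemma edge_weight_doubleton:
  "u \<noteq> v \<Longrightarrow> edge_weight k f {u, v} = (f u + f v) mod k"
  by (simp add: edge_weight_def)

definition vertex_count :: "'a set \<Rightarrow> ('a \<Rightarrow> nat) \<Rightarrow> nat \<Rightarrow> nat" where
  "vertex_count V f a = card {v \<in> V. f v = a}"

definition edge_count :: "nat \<Rightarrow> 'a set set \<Rightarrow> ('a \<Rightarrow> nat) \<Rightarrow> nat \<Rightarrow> nat" where
  "edge_count k E f a = card {e \<in> E. edge_weight k f e = a}"

definition cordial_labeling :: "nat \<Rightarrow> 'a set \<Rightarrow> 'a set set \<Rightarrow> ('a \<Rightarrow> nat) \<Rightarrow> bool" where
  "cordial_labeling k V E f \<longleftrightarrow>
     (\<forall>v\<in>V. f v < k) \<and>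
     (\<forall>a<k. \<forall>b<k. \<bar>int (vertex_count V f a) - int (vertex_count V f b)\<bar> \<le> 1) \<and>
     (\<forall>a<k. \<forall>b<k. \<bar>int (edge_count k E f a) - int (edge_count k E f b)\<bar> \<le> 1)"

definition cordial :: "nat \<Rightarrow> 'a set \<Rightarrow> 'a set set \<Rightarrow> bool" where
  "cordial k V E \<longleftrightarrow> (\<exists>f. cordial_labeling k V E f)"

end

theory Submission
  imports Defs "HOL-Combinatorics.Transposition"
begin

text \<open>
  Number the vertices of the tree such that every initial segment induces a subtree, and let \<open>\<pi> i\<close>
  be the parent of \<open>i\<close>. It suffices to label the vertices such that each block
  \<open>7m, \<dots>, 7m + 6\<close> carries distinct labels and the parent edges of each block
  \<open>7m + 1, \<dots>, 7m + 7\<close> carry distinct weights, since then every initial segment is balanced.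
  Suppose \<open>0, \<dots>, 7m\<close> are labelled. After a translation, \<open>7m\<close> has label 0, and the next six vertices
  need the labels \<open>1, \<dots>, 6\<close> in an order that makes their six weights distinct; the label of
  \<open>7m + 7\<close> is then free and is used to realise the missing weight. Such an order exists for every
  way of attaching six vertices to labelled vertices and to each other. This is a finite statement:
  choosing the lexicographically least description of the attachment among all
  renumberings and multiplications by units leaves a few thousand cases, which are checked by
  a search.
\<close>

section \<open>Six new vertices: encoding and exhaustive search\<close>

text \<open>
  Six new vertices \<open>0, \<dots>, 5\<close> are attached one after another. The parent of \<open>i\<close> is encoded by a number
  \<open>p i < 7 + i\<close>: a code below 7 is the label of a parent that is already labelled, and the code
  \<open>7 + j\<close> stands for the new vertex \<open>j\<close>.
\<close>

definition parent_label :: "(nat \<Rightarrow> nat) \<Rightarrow> nat \<Rightarrow> nat" where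
  "parent_label y q = (if q < 7 then q else y (q - 7))"

definition step_weight :: "(nat \<Rightarrow> nat) \<Rightarrow> (nat \<Rightarrow> nat) \<Rightarrow> nat \<Rightarrow> nat" where
  "step_weight p y i = (parent_label y (p i) + y i) mod 7"

definition extendable :: "(nat \<Rightarrow> nat) \<Rightarrow> bool" where
  "extendable p \<longleftrightarrow>
     (\<exists>y. inj_on y {..<6} \<and> y ` {..<6} \<subseteq> {1..6} \<and> inj_on (step_weight p y) {..<6})"

text \<open>
  A backtracking search for the labels of the new vertices: \<open>labs\<close> lists the label denoted by each
  code so far, \<open>av\<close> the labels still available and \<open>ws\<close> the weights already used. The operator
  \<open>find\<close> and the conditional are chosen because they stop at the first success when evaluated by
  rewriting, unlike \<open>\<or>\<close> and \<open>\<exists>\<close>; the modulus \<open>k\<close> is an argument so that its numeral is unfolded only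
  once.
\<close>

primrec solvable :: "nat \<Rightarrow> nat list \<Rightarrow> nat list \<Rightarrow> nat list \<Rightarrow> nat list \<Rightarrow> bool" where
  "solvable k [] labs av ws = True"
| "solvable k (p # ps) labs av ws =
     (find (\<lambda>y. let s = labs ! p + y; w = (if s < k then s else s - k) in
        if w \<in> set ws then False
        else solvable k ps (labs @ [y]) (remove1 y av) (w # ws)) av \<noteq> None)"

text \<open>
  Up to renumbering the new vertices and multiplying all labels by a unit modulo 7, the codes form a
  nondecreasing sequence whose first nonzero root label is 1; \<open>l\<close> is the previous code.
\<close>

primrec all_canonical :: "(nat list \<Rightarrow> bool) \<Rightarrow> nat \<Rightarrow> nat \<Rightarrow> nat \<Rightarrow> bool" where
  "all_canonical P 0 i l \<longleftrightarrow> P []"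
| "all_canonical P (Suc n) i l \<longleftrightarrow>
     list_all (\<lambda>q. all_canonical (\<lambda>qs. P (q # qs)) n (Suc i) q)
       (if l = 0 then 0 # 1 # [7..<7 + i] else [l..<7 + i])"

text \<open>Position q of \<open>labs @ ys\<close> is the label denoted by the code q, because the
  search appends each label it chooses. The clause on \<open>ws\<close> carries the induction: it
  keeps later weights apart from the one just used.\<close>

lemma solvable_labels:
  assumes "solvable k ps labs av ws" "distinct av" "set labs \<subseteq> {..<k}" "set av \<subseteq> {..<k}"
    and "\<And>i. i < length ps \<Longrightarrow> ps ! i < length labs + i"
  shows "\<exists>ys. length ys = length ps \<and> distinct ys \<and> set ys \<subseteq> set av \<and>
    distinct (map (\<lambda>i. ((labs @ ys) ! (ps ! i) + ys ! i) mod k) [0..<length ps]) \<and>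
    (\<forall>i<length ps. ((labs @ ys) ! (ps ! i) + ys ! i) mod k \<notin> set ws)"
  using assms
proof (induction ps arbitrary: labs av ws)
  case Nil
  then show ?case by simp
next
  case (Cons p ps)
  from Cons.prems(1) obtain y where y: "y \<in> set av"
    and s: "let s = labs ! p + y; w = (if s < k then s else s - k) in
        if w \<in> set ws then False
        else solvable k ps (labs @ [y]) (remove1 y av) (w # ws)"
    by (auto simp: find_None_iff simp del: Let_def)
  have p: "p < length labs" using Cons.prems(5)[of 0] by simp
  define w where "w = (labs ! p + y) mod k"
  have "labs ! p < k" "y < k"
    using p y Cons.prems(3,4) by (auto dest: nth_mem)
  then have "w = (if labs ! p + y < k then labs ! p + y else labs ! p + y - k)"
    unfolding w_def by (simp add: mod_if)
  with s have w: "w \<notin> set ws" and sol: "solvable k ps (labs @ [y]) (remove1 y av) (w # ws)"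
    by (auto simp: Let_def split: if_splits)
  have "\<exists>ys. length ys = length ps \<and> distinct ys \<and> set ys \<subseteq> set (remove1 y av) \<and>
    distinct (map (\<lambda>i. (((labs @ [y]) @ ys) ! (ps ! i) + ys ! i) mod k) [0..<length ps]) \<and>
    (\<forall>i<length ps. (((labs @ [y]) @ ys) ! (ps ! i) + ys ! i) mod k \<notin> set (w # ws))"
  proof (rule Cons.IH[OF sol])
    show "distinct (remove1 y av)" using Cons.prems(2) by simp
    show "set (labs @ [y]) \<subseteq> {..<k}" using Cons.prems(3) \<open>y < k\<close> by simp
    show "set (remove1 y av) \<subseteq> {..<k}" using Cons.prems(2,4) by auto
    show "ps ! i < length (labs @ [y]) + i" if "i < length ps" for i
      using Cons.prems(5)[of "Suc i"] that by simp
  qed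
  then obtain ys where ys: "length ys = length ps" "distinct ys" "set ys \<subseteq> set (remove1 y av)"
    "distinct (map (\<lambda>i. ((labs @ y # ys) ! (ps ! i) + ys ! i) mod k) [0..<length ps])"
    "\<forall>i<length ps. ((labs @ y # ys) ! (ps ! i) + ys ! i) mod k \<notin> set (w # ws)"
    by auto
  have w0: "((labs @ y # ys) ! p + y) mod k = w"
    using p by (simp add: nth_append w_def)
  have upt: "[0..<length (p # ps)] = 0 # map Suc [0..<length ps]"
    by (simp add: map_Suc_upt upt_conv_Cons del: upt_Suc)
  show ?case
  proof (intro exI[of _ "y # ys"] conjI allI impI)
    show "distinct (y # ys)" "set (y # ys) \<subseteq> set av"
      using ys(2,3) y Cons.prems(2) by auto
    show "distinct (map (\<lambda>i. ((labs @ y # ys) ! ((p # ps) ! i) + (y # ys) ! i) mod k)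
        [0..<length (p # ps)])"
      unfolding upt using ys(4,5) w0 by (auto simp: o_def)
    show "((labs @ y # ys) ! ((p # ps) ! i) + (y # ys) ! i) mod k \<notin> set ws"
      if "i < length (p # ps)" for i
      using that w ys(5) w0 by (cases i) auto
  qed (use ys(1) in simp)
qed

text \<open>The initial list 0, ..., 6 makes each code below 7 look up itself as a label, and the
  initial \<open>l = 0\<close> lets the first code be 0 or 1.\<close>

lemma all_canonical_solvable:
  "all_canonical (\<lambda>ps. solvable 7 ps [0, 1, 2, 3, 4, 5, 6] [1, 2, 3, 4, 5, 6] []) (Suc 5) 0 0"
  by code_simp

section \<open>Reduction of arbitrary attachments to canonical ones\<close>

text \<open>Exchanging the new vertices \<open>i\<close> and \<open>i + 1\<close> permutes the
  positions of the code sequence and also the codes 7 + i and 8 + i that refer to them. Labels for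
  the renamed attachment are carried back by the same transposition.\<close>

lemma extendable_swap:
  assumes "extendable (\<lambda>j. transpose (7 + i) (8 + i) (p (transpose i (Suc i) j)))" "i < 5"
  shows "extendable p"
proof -
  let ?t = "transpose i (Suc i)"
  let ?q = "\<lambda>j. transpose (7 + i) (8 + i) (p (?t j))"
  from assms(1) obtain y where y: "inj_on y {..<6}" "y ` {..<6} \<subseteq> {1..6}"
    "inj_on (step_weight ?q y) {..<6}"
    unfolding extendable_def by blast
  have t: "?t ` {..<6} = {..<6}"
    using assms(2) by simp
  have "parent_label (y \<circ> ?t) k = parent_label y (transpose (7 + i) (8 + i) k)" for k
    by (auto simp: parent_label_def transpose_def)
  then have "step_weight p (y \<circ> ?t) = step_weight ?q y \<circ> ?t"
    by (auto simp: step_weight_def)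
  then have "inj_on (step_weight p (y \<circ> ?t)) {..<6}"
    using y(3) t by (simp add: comp_inj_on_iff[symmetric] inj_on_subset)
  moreover have "inj_on (y \<circ> ?t) {..<6}"
    using y(1) t by (simp add: comp_inj_on_iff[symmetric] inj_on_subset)
  moreover have "(y \<circ> ?t) ` {..<6} \<subseteq> {1..6}"
    using y(2) t by (metis image_comp)
  ultimately show ?thesis
    unfolding extendable_def by blast
qed

text \<open>A unit modulo 7 permutes the nonzero labels and the weights. Labels for the scaled
  attachment are carried back by the inverse \<open>d\<close> of \<open>c\<close>.\<close>

lemma extendable_scale:
  assumes "extendable (\<lambda>j. if p j < 7 then c * p j mod 7 else p j)" and "c * d mod 7 = 1"
  shows "extendable p"
proof -
  let ?q = "\<lambda>j. if p j < 7 then c * p j mod 7 else p j"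
  from assms(1) obtain y where y: "inj_on y {..<6}" "y ` {..<6} \<subseteq> {1..6}"
    "inj_on (step_weight ?q y) {..<6}"
    unfolding extendable_def by blast
  define z where "z j = d * y j mod 7" for j
  have cd: "c * (d * k mod 7) mod 7 = k mod 7" for k
  proof -
    have "c * (d * k mod 7) mod 7 = (c * d mod 7) * k mod 7"
      by (metis mod_mult_left_eq mod_mult_right_eq mult.assoc)
    then show ?thesis using assms(2) by simp
  qed
  have cz: "c * z j mod 7 = y j" if "j < 6" for j
    using y(2) that cd[of "y j"] by (force simp: z_def)
  have "inj_on z {..<6}"
    using y(1) cz by (metis (no_types, lifting) inj_on_def lessThan_iff)
  moreover have "z ` {..<6} \<subseteq> {1..6}"
  proof -
    have "z j \<in> {1..6}" if "j < 6" for j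
    proof -
      have "z j \<noteq> 0" using cz[OF that] y(2) that by (metis atLeastAtMost_iff image_subset_iff
            lessThan_iff mod_0 mult_0_right not_one_le_zero)
      moreover have "z j < 7" by (simp add: z_def)
      ultimately show ?thesis by simp
    qed
    then show ?thesis by auto
  qed
  moreover have "inj_on (step_weight p z) {..<6}"
  proof -
    \<comment> \<open>Weights scale along with labels, so equal weights under \<open>z\<close> give
      equal weights under \<open>y\<close>.\<close>
    have "c * step_weight p z j mod 7 = step_weight ?q y j" for j
    proof -
      have "c * parent_label z (p j) mod 7 = parent_label y (?q j) mod 7"
        by (simp add: parent_label_def z_def cd)
      moreover have "c * z j mod 7 = y j mod 7"
        by (simp add: z_def cd)
      moreover have "c * step_weight p z j mod 7 =
          (c * parent_label z (p j) mod 7 + c * z j mod 7) mod 7"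
        by (simp add: step_weight_def mod_simps algebra_simps)
      ultimately show ?thesis
        by (simp add: step_weight_def mod_simps)
    qed
    then show ?thesis
      using y(3) by (metis (no_types, lifting) inj_on_def)
  qed
  ultimately show ?thesis
    unfolding extendable_def by blast
qed

lemma all_canonical_SucD:
  assumes "all_canonical P (Suc n) i l"
    and "q \<in> set (if l = 0 then 0 # 1 # [7..<7 + i] else [l..<7 + i])"
  shows "all_canonical (\<lambda>qs. P (q # qs)) n (Suc i) q"
  using assms by (simp only: all_canonical.simps list_all_iff)

lemma extendable_if_canonical:
  assumes "\<And>i. i < 6 \<Longrightarrow> p i < 7 + i"
    and "\<And>i. i < 5 \<Longrightarrow> p i \<le> p (Suc i)"
    and "\<And>k. k < 6 \<Longrightarrow> (\<And>j. j < k \<Longrightarrow> p j = 0) \<Longrightarrow> p k < 2 \<or> 7 \<le> p k"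
  shows "extendable p"
proof -
  let ?ps = "map p [0..<6]"
  \<comment> \<open>If \<open>p i = 0\<close>, monotonicity makes all earlier codes 0 as well, and
    then the third assumption restricts the next code.\<close>
  have step: "p (Suc i) \<in> set (if p i = 0 then 0 # 1 # [7..<7 + Suc i] else [p i..<7 + Suc i])"
    if "i < 5" for i
  proof (cases "p i = 0")
    case True
    have "p j = 0" if "j \<le> i" for j
      using that \<open>i < 5\<close>
    proof (induction rule: inc_induct)
      case base then show ?case using True by simp
    next
      case (step n) then show ?case using assms(2)[of n] by simp
    qed
    then have "p (Suc i) < 2 \<or> 7 \<le> p (Suc i)"
      using assms(3)[of "Suc i"] that by auto
    then show ?thesis using True assms(1)[of "Suc i"] that by auto
  next
    case False
    then show ?thesis using assms(1)[of "Suc i"] assms(2)[of i] that by auto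
  qed
  \<comment> \<open>Here \<open>n\<close> codes remain, at positions 6 - n to 5, and 5 - n is the
    position of the previous code. The codes already read are absorbed into
    \<open>P\<close>.\<close>
  have tail: "P (map p [6 - n..<6])"
    if "all_canonical P n (6 - n) (p (5 - n))" "n \<le> 5" for n P
    using that
  proof (induction n arbitrary: P)
    case 0
    then show ?case by simp
  next
    case (Suc n)
    define i where "i = 4 - n"
    have i: "i < 5" "5 - n = Suc i" "6 - n = Suc (Suc i)" "6 - Suc n = Suc i" "5 - Suc n = i"
      using Suc.prems(2) by (auto simp: i_def)
    have "all_canonical (\<lambda>qs. P (p (Suc i) # qs)) n (6 - n) (p (5 - n))"
      unfolding i(2,3) by (rule all_canonical_SucD[OF Suc.prems(1)[unfolded i(4,5)] step[OF i(1)]])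
    from Suc.IH[OF this Suc_leD[OF Suc.prems(2)]] have "P (p (Suc i) # map p [6 - n..<6])" .
    moreover have "[Suc i..<6] = Suc i # [6 - n..<6]"
      unfolding i(3) using i(1) by (intro upt_conv_Cons) simp
    ultimately show ?case by (simp only: i(4) list.map)
  qed
  let ?S = "\<lambda>ps. solvable 7 ps [0, 1, 2, 3, 4, 5, 6] [1, 2, 3, 4, 5, 6] []"
  note all_canonical_solvable
  moreover have "p 0 \<in> set (if (0::nat) = 0 then 0 # 1 # [7..<7 + 0] else [0..<7 + 0])"
    using assms(3)[of 0] assms(1)[of 0] by auto
  ultimately have "all_canonical (\<lambda>qs. ?S (p 0 # qs)) 5 (Suc 0) (p 0)"
    by (rule all_canonical_SucD)
  with tail[of "\<lambda>qs. ?S (p 0 # qs)" 5] have "?S (p 0 # map p [Suc 0..<6])"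
    by (simp del: solvable.simps all_canonical.simps upt_rec_numeral)
  then have sol: "?S ?ps"
    using upt_conv_Cons[of 0 6] by (simp del: solvable.simps upt_rec_numeral)
  have upt7: "[0, 1, 2, 3, 4, 5, 6] = [0..<7]"
    by (simp add: upt_rec)
  have "\<exists>ys. length ys = length ?ps \<and> distinct ys \<and> set ys \<subseteq> set [1, 2, 3, 4, 5, 6] \<and>
    distinct (map (\<lambda>i. (([0..<7] @ ys) ! (?ps ! i) + ys ! i) mod 7) [0..<length ?ps]) \<and>
    (\<forall>i<length ?ps. (([0..<7] @ ys) ! (?ps ! i) + ys ! i) mod 7 \<notin> set [])"
    by (rule solvable_labels[OF sol[unfolded upt7]]) (use assms(1) in auto)
  then obtain ys where ys: "length ys = 6" "distinct ys" "set ys \<subseteq> set [1, 2, 3, 4, 5, 6]"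
    "distinct (map (\<lambda>i. (([0..<7] @ ys) ! (?ps ! i) + ys ! i) mod 7) [0..<6])"
    by (simp del: map_eq_conv upt_rec_numeral) blast
  have "step_weight p ((!) ys) i = (([0..<7] @ ys) ! (?ps ! i) + ys ! i) mod 7" if "i < 6" for i
    using that by (simp add: step_weight_def parent_label_def nth_append)
  with ys(4) have "inj_on (step_weight p ((!) ys)) {..<6}"
    by (auto simp: distinct_map inj_on_def)
  moreover have "inj_on ((!) ys) {..<6}"
    using ys(1,2) by (auto simp: inj_on_def nth_eq_iff_index_eq)
  moreover have "(!) ys ` {..<6} \<subseteq> {1..6}"
  proof -
    have "set ys \<subseteq> {1..6}" using ys(3) by auto
    then show ?thesis using ys(1) by (intro image_subsetI) (metis lessThan_iff nth_mem subsetD)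
  qed
  ultimately show ?thesis
    unfolding extendable_def by blast
qed

lemma lex_map_upt:
  fixes p q :: "nat \<Rightarrow> nat"
  assumes "k < n" "\<And>j. j < k \<Longrightarrow> q j = p j" "q k < p k"
  shows "(map q [0..<n], map p [0..<n]) \<in> lex less_than"
proof -
  have "[0..<n] = [0..<k] @ k # [Suc k..<n]"
    using assms(1) upt_add_eq_append[of 0 k "n - k"] upt_conv_Cons[of k n] by simp
  moreover have "map q [0..<k] = map p [0..<k]"
    using assms(2) by simp
  ultimately show ?thesis
    using assms(3) by (force simp: lex_conv)
qed

text \<open>The least description is reached by descent in the lexicographic order: a descent
  between neighbouring codes is removed by a swap, and a first nonzero root label other than 1 is
  scaled to 1. Either move lowers the first code that it changes.\<close>

lemma extendable_if_valid:
  assumes "\<And>i. i < 6 \<Longrightarrow> p i < 7 + i"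
  shows "extendable p"
proof -
  have wf: "wf (inv_image (lex less_than) (\<lambda>p. map p [0..<6]))"
    by (intro wf_inv_image wf_lex wf_less_than)
  show ?thesis
    using wf assms
  proof (induction p rule: wf_induct_rule)
    case (less p)
    show ?case
    proof (cases "\<exists>i<5. p (Suc i) < p i")
      case True
      then obtain i where i: "i < 5" "p (Suc i) < p i" by blast
      let ?q = "\<lambda>j. transpose (7 + i) (8 + i) (p (transpose i (Suc i) j))"
      have small: "transpose (7 + i) (8 + i) k = k" if "k < 7 + i" for k
        using that by (simp add: transpose_def)
      \<comment> \<open>Since \<open>p (Suc i) < p i < 7 + i\<close>, vertex \<open>i + 1\<close> is
        not attached to \<open>i\<close>; hence after the swap parents still precede their
        children.\<close>
      have pi: "p i < 7 + i" using less.prems[of i] i by simp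
      have "(?q, p) \<in> inv_image (lex less_than) (\<lambda>p. map p [0..<6])"
        unfolding in_inv_image
      proof (rule lex_map_upt)
        show "?q j = p j" if "j < i" for j
          using that small[of "p j"] less.prems[of j] i by simp
        show "?q i < p i" using i pi small[of "p (Suc i)"] by simp
      qed (use i in simp)
      moreover have "?q j < 7 + j" if "j < 6" for j
      proof -
        consider "j < i" | "j = i" | "j = Suc i" | "j > Suc i" by linarith
        then show ?thesis
        proof cases
          case 1
          then show ?thesis using that small[of "p j"] less.prems[of j] by simp
        next
          case 2
          then show ?thesis using i pi small[of "p (Suc i)"] by simp
        next
          case 3
          then show ?thesis using i pi small[of "p i"] by simp
        next
          case 4
          then show ?thesis using that less.prems[of j] by (auto simp: transpose_def)
        qed
      qed
      ultimately show ?thesis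
        using less.IH extendable_swap i(1) by blast
    next
      case sorted: False
      show ?thesis
      proof (cases "\<exists>k<6. (\<forall>j<k. p j = 0) \<and> 2 \<le> p k \<and> p k < 7")
        case True
        then obtain k where k: "k < 6" "\<And>j. j < k \<Longrightarrow> p j = 0" "2 \<le> p k" "p k < 7" by blast
        obtain c where c: "c * p k mod 7 = 1"
        proof -
          have "p k \<in> {2, 3, 4, 5, 6}" using k(3,4) by auto
          \<comment> \<open>The factors are the inverses of 2, 3, 4, 5, 6 in this order.\<close>
          then have "4 * p k mod 7 = 1 \<or> 5 * p k mod 7 = 1 \<or> 2 * p k mod 7 = 1 \<or>
              3 * p k mod 7 = 1 \<or> 6 * p k mod 7 = 1"
            by auto
          then show thesis using that by blast
        qed
        let ?q = "\<lambda>j. if p j < 7 then c * p j mod 7 else p j"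
        have "(?q, p) \<in> inv_image (lex less_than) (\<lambda>p. map p [0..<6])"
          unfolding in_inv_image using k c by (intro lex_map_upt[of k]) auto
        moreover have "?q j < 7 + j" if "j < 6" for j
          using less.prems[OF that] mod_less_divisor[of 7 "c * p j"] by (auto simp: trans_less_add1)
        ultimately show ?thesis
          using less.IH extendable_scale[OF _ c] by blast
      next
        case False
        show ?thesis
        proof (rule extendable_if_canonical)
          show "p i \<le> p (Suc i)" if "i < 5" for i
            using sorted that by (meson not_le)
          show "p k < 2 \<or> 7 \<le> p k" if "k < 6" "\<And>j. j < k \<Longrightarrow> p j = 0" for k
            using False that by (meson not_le)
        qed (use less.prems in simp)
      qed
    qed
  qed
qed

section \<open>Labelling block by block\<close>

lemma mod_add_right_cancel_less:
  fixes a b c n :: nat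
  assumes "(a + c) mod n = (b + c) mod n" "a < n" "b < n"
  shows "a = b"
proof -
  obtain k l where "a + c + n * k = b + c + n * l"
    using assms(1) by (auto simp: nat_mod_eq_iff)
  then have "a mod n = b mod n"
    by (auto simp: nat_mod_eq_iff)
  then show ?thesis using assms(2,3) by simp
qed

text \<open>Vertex blocks and edge blocks are offset by one: \<open>N\<close> opens the vertex block
  and keeps its old label, while \<open>N + 7\<close> closes the edge block and already belongs to
  the next vertex block.\<close>

lemma block_labeling_step:
  fixes g \<pi> :: "nat \<Rightarrow> nat"
  assumes par: "\<And>i. 0 < i \<Longrightarrow> \<pi> i < i" and g: "\<And>i. g i < 7"
  shows "\<exists>h. (\<forall>i. h i < 7) \<and> (\<forall>i\<le>N. h i = g i) \<and> inj_on h {N..<N + 7} \<and>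
    inj_on (\<lambda>i. (h i + h (\<pi> i)) mod 7) {N + 1..<N + 8}"
proof -
  define s where "s = g N"
  \<comment> \<open>Labels of old parents are taken relative to \<open>s\<close>, adding 7 to avoid
    truncated subtraction; the new vertex \<open>N + 1 + j\<close> gets the code 7 + j.\<close>
  define p where "p i = (if \<pi> (N + 1 + i) \<le> N then (g (\<pi> (N + 1 + i)) + 7 - s) mod 7
      else 7 + (\<pi> (N + 1 + i) - (N + 1)))" for i
  have "extendable p"
  proof (rule extendable_if_valid)
    show "p i < 7 + i" if "i < 6" for i
      using par[of "N + 1 + i"] by (auto simp: p_def intro: trans_less_add1)
  qed
  then obtain y where y: "inj_on y {..<6}" "y ` {..<6} \<subseteq> {1..6}" "inj_on (step_weight p y) {..<6}"
    unfolding extendable_def by blast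
  define h0 where "h0 i = (if i \<le> N then g i else (y (i - (N + 1)) + s) mod 7)" for i
  let ?w0 = "\<lambda>i. (h0 i + h0 (\<pi> i)) mod 7"
  have sg: "s < 7" using g by (simp add: s_def)
  \<comment> \<open>Undoing the translation moves both ends of an edge by \<open>s\<close>, so all
    six weights shift by the same amount \<open>s + s\<close> and stay distinct.\<close>
  have w0: "?w0 (N + 1 + i) = (step_weight p y i + (s + s)) mod 7" for i
  proof -
    have "h0 (\<pi> (N + 1 + i)) mod 7 = (parent_label y (p i) + s) mod 7"
      using sg by (auto simp: h0_def p_def parent_label_def mod_simps)
    moreover have "h0 (N + 1 + i) = (y i + s) mod 7"
      by (simp add: h0_def)
    ultimately have "?w0 (N + 1 + i) = ((y i + s) mod 7 + (parent_label y (p i) + s) mod 7) mod 7"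
      by (metis mod_add_right_eq)
    then show ?thesis
      by (simp add: step_weight_def mod_simps) (simp add: ac_simps)
  qed
  have shift: "{N + 1..<N + 7} = (+) (N + 1) ` {..<6}"
    unfolding lessThan_atLeast0 image_add_atLeastLessThan by (simp add: add.commute)
  have inj_w0: "inj_on ?w0 {N + 1..<N + 7}"
    unfolding shift
  proof (rule inj_on_imageI, rule inj_onI, unfold o_def)
    fix i j assume ij: "i \<in> {..<6}" "j \<in> {..<6}" "?w0 (N + 1 + i) = ?w0 (N + 1 + j)"
    have "step_weight p y i = step_weight p y j"
      by (rule mod_add_right_cancel_less[of _ "s + s" 7])
        (use ij(3) w0 in \<open>simp_all add: step_weight_def\<close>)
    then show "i = j" using y(3) ij by (auto dest: inj_onD)
  qed
  have "card (?w0 ` {N + 1..<N + 7}) = 6"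
    using card_image[OF inj_w0] by simp
  then have "?w0 ` {N + 1..<N + 7} \<noteq> {..<7}"
    by (metis card_lessThan numeral_eq_iff semiring_norm(86) num.distinct(5) semiring_norm(90))
  then obtain w where w: "w < 7" "w \<notin> ?w0 ` {N + 1..<N + 7}"
    by force
  \<comment> \<open>The label of \<open>N + 7\<close> is the missing weight minus the label of its
    parent, which lies below \<open>N + 7\<close> and so is already fixed.\<close>
  define h where "h = h0(N + 7 := (w + 7 - h0 (\<pi> (N + 7))) mod 7)"
  have h0: "h0 i < 7" for i using g by (simp add: h0_def)
  have h_eq: "h i = h0 i" if "i < N + 7" for i
    using that by (simp add: h_def)
  have wh: "(h i + h (\<pi> i)) mod 7 = ?w0 i" if "i \<in> {N + 1..<N + 7}" for i
    using that par[of i] by (simp add: h_eq)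
  have "h (\<pi> (N + 7)) = h0 (\<pi> (N + 7))"
    using par[of "N + 7"] by (simp add: h_eq)
  then have "(h (N + 7) + h (\<pi> (N + 7))) mod 7 = (w + 7) mod 7"
    using h0[of "\<pi> (N + 7)"] by (simp add: h_def mod_simps)
  then have wlast: "(h (N + 7) + h (\<pi> (N + 7))) mod 7 = w"
    using w(1) by simp
  have "inj_on (\<lambda>i. (h i + h (\<pi> i)) mod 7) (insert (N + 7) {N + 1..<N + 7})"
    unfolding inj_on_insert
  proof
    show "inj_on (\<lambda>i. (h i + h (\<pi> i)) mod 7) {N + 1..<N + 7}"
      using inj_w0 wh by (subst inj_on_cong[of _ _ ?w0]) auto
    show "(h (N + 7) + h (\<pi> (N + 7))) mod 7 \<notin>
        (\<lambda>i. (h i + h (\<pi> i)) mod 7) ` ({N + 1..<N + 7} - {N + 7})"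
      unfolding wlast using w(2) wh by auto
  qed
  then have "inj_on (\<lambda>i. (h i + h (\<pi> i)) mod 7) {N + 1..<N + 8}"
    by (rule inj_on_subset) auto
  moreover have "inj_on h {N..<N + 7}"
  proof -
    \<comment> \<open>These are the labels of the vertex block relative to \<open>s\<close>: the
      value 0 at \<open>N\<close> is the one that \<open>y\<close> avoids.\<close>
    define z where "z i = (if i = N then 0 else y (i - (N + 1)))" for i
    have z: "z i < 7" if "i \<in> {N..<N + 7}" for i
    proof (cases "i = N")
      case False
      then have "y (i - (N + 1)) \<in> {1..6}"
        using that by (intro subsetD[OF y(2)] imageI) auto
      then show ?thesis using False by (simp add: z_def)
    qed (simp add: z_def)
    have hz: "h i = (z i + s) mod 7" if "i \<in> {N..<N + 7}" for i
      using that sg h_eq[of i] by (auto simp: h0_def z_def s_def)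
    have inj_z: "inj_on z {N..<N + 7}"
    proof (rule inj_onI)
      fix i j assume ij: "i \<in> {N..<N + 7}" "j \<in> {N..<N + 7}" "z i = z j"
      have z0: "z k \<noteq> 0" if "k \<in> {N..<N + 7}" "k \<noteq> N" for k
      proof -
        have "y (k - (N + 1)) \<in> {1..6}"
          using that by (intro subsetD[OF y(2)] imageI) auto
        then show ?thesis using that by (simp add: z_def)
      qed
      show "i = j"
      proof (cases "i = N \<or> j = N")
        case True
        moreover have "z N = 0" by (simp add: z_def)
        ultimately show ?thesis using ij z0[of i] z0[of j] by metis
      next
        case False
        then have "y (i - (N + 1)) = y (j - (N + 1))"
          using ij(3) by (simp add: z_def)
        moreover have "i - (N + 1) \<in> {..<6}" "j - (N + 1) \<in> {..<6}"
          using ij(1,2) False by auto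
        ultimately have "i - (N + 1) = j - (N + 1)"
          by (rule inj_onD[OF y(1)])
        moreover have "N + 1 \<le> i" "N + 1 \<le> j" using False ij(1,2) by auto
        ultimately show ?thesis by simp
      qed
    qed
    show ?thesis
    proof (rule inj_onI)
      fix i j assume ij: "i \<in> {N..<N + 7}" "j \<in> {N..<N + 7}" "h i = h j"
      have "z i = z j"
        by (rule mod_add_right_cancel_less[of _ s 7]) (use ij(3) hz[OF ij(1)] hz[OF ij(2)]
          z[OF ij(1)] z[OF ij(2)] in simp_all)
      then show "i = j" using inj_onD[OF inj_z] ij by blast
    qed
  qed
  moreover have "\<forall>i. h i < 7" using h0 by (simp add: h_def)
  moreover have "\<forall>i\<le>N. h i = g i" by (simp add: h_def h0_def)
  ultimately show ?thesis by blast
qed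

lemma block_labeling:
  fixes \<pi> :: "nat \<Rightarrow> nat"
  assumes par: "\<And>i. 0 < i \<Longrightarrow> \<pi> i < i"
  shows "\<exists>g :: nat \<Rightarrow> nat. (\<forall>i. g i < 7) \<and> (\<forall>m<M. inj_on g {7 * m..<7 * m + 7} \<and>
    inj_on (\<lambda>i. (g i + g (\<pi> i)) mod 7) {7 * m + 1..<7 * m + 8})"
proof (induction M)
  case 0
  show ?case by (intro exI[of _ "\<lambda>_. 0"]) simp
next
  case (Suc M)
  then obtain g :: "nat \<Rightarrow> nat" where g: "\<And>i. g i < 7" "\<And>m. m < M \<Longrightarrow> inj_on g {7 * m..<7 * m + 7}"
    "\<And>m. m < M \<Longrightarrow> inj_on (\<lambda>i. (g i + g (\<pi> i)) mod 7) {7 * m + 1..<7 * m + 8}"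
    by blast
  have "\<exists>h. (\<forall>i. h i < 7) \<and> (\<forall>i\<le>7 * M. h i = g i) \<and> inj_on h {7 * M..<7 * M + 7} \<and>
      inj_on (\<lambda>i. (h i + h (\<pi> i)) mod 7) {7 * M + 1..<7 * M + 8}"
    by (rule block_labeling_step[OF par g(1)])
  then obtain h where h: "\<forall>i. h i < 7"
    "\<forall>i\<le>7 * M. h i = g i" "inj_on h {7 * M..<7 * M + 7}"
    "inj_on (\<lambda>i. (h i + h (\<pi> i)) mod 7) {7 * M + 1..<7 * M + 8}"
    by blast
  have "inj_on h {7 * m..<7 * m + 7} \<and>
      inj_on (\<lambda>i. (h i + h (\<pi> i)) mod 7) {7 * m + 1..<7 * m + 8}" if "m < Suc M" for m
  proof (cases "m = M")
    case True
    then show ?thesis using h by simp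
  next
    case False
    then have m: "m < M" using that by simp
    have "inj_on h {7 * m..<7 * m + 7} \<longleftrightarrow> inj_on g {7 * m..<7 * m + 7}"
      using m h(2) by (intro inj_on_cong) auto
    moreover have "inj_on (\<lambda>i. (h i + h (\<pi> i)) mod 7) {7 * m + 1..<7 * m + 8} \<longleftrightarrow>
        inj_on (\<lambda>i. (g i + g (\<pi> i)) mod 7) {7 * m + 1..<7 * m + 8}"
    proof (rule inj_on_cong)
      fix i assume i: "i \<in> {7 * m + 1..<7 * m + 8}"
      \<comment> \<open>Earlier edge blocks reach up to index \<open>7 * M\<close> at most and
        parents are smaller still, so only labels on which \<open>h\<close> and \<open>g\<close>
        agree are involved.\<close>
      then have "i \<le> 7 * M" "\<pi> i < i" using m par[of i] by auto
      then show "(h i + h (\<pi> i)) mod 7 = (g i + g (\<pi> i)) mod 7" using h(2) by simp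
    qed
    ultimately show ?thesis using g(2,3) m by blast
  qed
  then show ?case using h(1) by blast
qed

section \<open>Balance of initial segments\<close>

text \<open>On a full block, \<open>k\<close> distinct values below \<open>k\<close> take each value
  exactly once; the incomplete last block adds each value at most once.\<close>

lemma block_balanced:
  fixes h :: "nat \<Rightarrow> nat"
  assumes "\<And>i. h i < k" "\<And>m. m \<le> n div k \<Longrightarrow> inj_on h {k * m..<k * m + k}" "a < k"
  shows "card {i. i < n \<and> h i = a} \<in> {n div k, n div k + 1}"
proof -
  have full: "card {i. i < k * q \<and> h i = a} = q" if "q \<le> n div k" for q
    using that
  proof (induction q)
    case 0
    then show ?case by simp
  next
    case (Suc q)
    have "h ` {k * q..<k * q + k} = {..<k}"
      by (rule card_subset_eq) (use assms(1) card_image[OF assms(2)[of q]] Suc.prems in auto)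
    then obtain j where j: "j \<in> {k * q..<k * q + k}" "h j = a"
      using assms(3) by (metis imageE lessThan_iff)
    have "i = j" if "i \<in> {k * q..<k * q + k}" "h i = a" for i
      using inj_onD[OF assms(2)[of q] _ that(1) j(1)] that(2) j(2) Suc.prems by simp
    then have "{i \<in> {k * q..<k * q + k}. h i = a} = {j}" using j by blast
    moreover have "{i. i < k * Suc q \<and> h i = a} =
        {i \<in> {k * q..<k * q + k}. h i = a} \<union> {i. i < k * q \<and> h i = a}"
      by auto
    ultimately show ?case using Suc j by simp
  qed
  let ?B = "{i. k * (n div k) \<le> i \<and> i < n \<and> h i = a}"
  have "n < k * (n div k) + k"
    using assms(3) by (metis dividend_less_times_div gr_implies_not0 neq0_conv add.commute mult.commute)
  then have "\<forall>i\<in>?B. \<forall>j\<in>?B. i = j"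
    using inj_onD[OF assms(2)[of "n div k"]] by auto
  then have "card ?B \<le> 1"
    by (simp add: card_le_Suc0_iff_eq)
  then have "card ?B = 0 \<or> card ?B = 1" by linarith
  moreover have "{i. i < n \<and> h i = a} = {i. i < k * (n div k) \<and> h i = a} \<union> ?B"
    by (auto simp: not_less) (meson less_le_trans times_div_less_eq_dividend)
  moreover have "card ({i. i < k * (n div k) \<and> h i = a} \<union> ?B) = n div k + card ?B"
    using full[of "n div k"] by (subst card_Un_disjoint) auto
  ultimately have "card {i. i < n \<and> h i = a} = n div k \<or> card {i. i < n \<and> h i = a} = n div k + 1"
    by (simp only:) linarith
  then show ?thesis by simp
qed

section \<open>Numbering the vertices of a tree by parents\<close>

text \<open>If no edge left \<open>W\<close>, every walk starting in \<open>W\<close> would stay in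
  \<open>W\<close>, contradicting connectedness.\<close>

lemma connected_graph_edge_out:
  assumes "connected_graph V E" "W \<subseteq> V" "W \<noteq> {}" "W \<noteq> V"
  shows "\<exists>u\<in>W. \<exists>v\<in>V - W. {v, u} \<in> E"
proof (rule ccontr)
  assume no: "\<not> ?thesis"
  obtain a b where ab: "a \<in> W" "b \<in> V - W" using assms by blast
  then obtain p where p: "is_walk V E p" "hd p = a" "last p = b"
    using assms unfolding connected_graph_def by blast
  have "set p \<subseteq> W"
    using p(1) p(2) ab(1)
  proof (induction p arbitrary: a)
    case Nil
    then show ?case by simp
  next
    case (Cons x xs)
    show ?case
    proof (cases xs)
      case Nil
      then show ?thesis using Cons by simp
    next
      case (Cons y ys)
      with \<open>is_walk V E (x # xs)\<close> have "is_walk V E xs" "{y, x} \<in> E" "y \<in> V"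
        by (auto simp: is_walk_def insert_commute)
      moreover have "x \<in> W" using Cons.prems by simp
      ultimately have "y \<in> W" using no by blast
      then show ?thesis using Cons.IH[of y] \<open>is_walk V E xs\<close> \<open>x \<in> W\<close> Cons by simp
    qed
  qed
  then show False using p ab last_in_set[of p] by (auto simp: is_walk_def)
qed

text \<open>The list of vertices grows along edges that leave the part already listed. The bound on
  \<open>\<pi>\<close> is kept for all positive indices, also beyond \<open>n\<close>, because
  \<open>block_labeling\<close> labels all natural numbers.\<close>

lemma connected_graph_ordering:
  assumes "connected_graph V E" "finite V" "0 < n" "n \<le> card V"
  shows "\<exists>v \<pi>. inj_on v {..<n} \<and> v ` {..<n} \<subseteq> V \<and>
    (\<forall>i. 0 < i \<longrightarrow> \<pi> i < i) \<and> (\<forall>i\<in>{1..<n}. {v i, v (\<pi> i)} \<in> E)"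
  using assms(3,4)
proof (induction n rule: nat_induct_non_zero)
  case 1
  obtain r where "r \<in> V" using assms(1) unfolding connected_graph_def by blast
  then show ?case
    by (intro exI[of _ "\<lambda>_. r"] exI[of _ "\<lambda>_. 0"]) (auto simp: inj_on_def)
next
  case (Suc n)
  from Suc.IH[OF Suc_leD[OF Suc.prems]] obtain v \<pi> where v: "inj_on v {..<n}" "v ` {..<n} \<subseteq> V"
    and \<pi>: "\<And>i. 0 < i \<Longrightarrow> \<pi> i < i" "\<And>i. i \<in> {1..<n} \<Longrightarrow> {v i, v (\<pi> i)} \<in> E"
    by blast
  have "v ` {..<n} \<noteq> V"
    using card_image[OF v(1)] Suc.prems by auto
  then obtain j x where jx: "j < n" "x \<in> V" "x \<notin> v ` {..<n}" "{x, v j} \<in> E"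
    using connected_graph_edge_out[OF assms(1) v(2)] Suc.hyps by auto
  let ?v = "v(n := x)" and ?\<pi> = "\<pi>(n := j)"
  have "inj_on ?v {..<Suc n}"
    using v(1) jx(3) by (auto simp: lessThan_Suc inj_on_def)
  moreover have "?v ` {..<Suc n} \<subseteq> V"
    using v(2) jx(2) by (auto simp: lessThan_Suc)
  moreover have "\<forall>i. 0 < i \<longrightarrow> ?\<pi> i < i"
    using \<pi>(1) jx(1) by simp
  moreover have "\<forall>i\<in>{1..<Suc n}. {?v i, ?v (?\<pi> i)} \<in> E"
  proof
    fix i assume i: "i \<in> {1..<Suc n}"
    show "{?v i, ?v (?\<pi> i)} \<in> E"
      using i jx(1,4) \<pi>(1)[of i] \<pi>(2)[of i] by (cases "i = n") auto
  qed
  ultimately show ?case by blast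
qed

text \<open>Induction on the larger end \<open>j\<close>: a path from \<open>i\<close> to
  \<open>\<pi> j\<close> can be chosen strictly below \<open>j\<close>, so appending
  \<open>j\<close> keeps it free of repetitions.\<close>

lemma path_to_index:
  fixes \<pi> :: "nat \<Rightarrow> nat"
  assumes "\<And>i. 0 < i \<Longrightarrow> \<pi> i < i" "i \<le> j"
  shows "\<exists>p. p \<noteq> [] \<and> set p \<subseteq> {..j} \<and> distinct p \<and> hd p = i \<and> last p = j \<and>
    successively (\<lambda>a b. 0 < a \<and> b = \<pi> a \<or> 0 < b \<and> a = \<pi> b) p"
  using assms(2)
proof (induction j arbitrary: i rule: less_induct)
  case (less j)
  let ?adj = "\<lambda>a b. 0 < a \<and> b = \<pi> a \<or> 0 < b \<and> a = \<pi> b"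
  show ?case
  proof (cases "i = j")
    case True
    then show ?thesis by (intro exI[of _ "[i]"]) simp
  next
    case False
    then have j: "\<pi> j < j" "0 < j" "i < j" using less.prems assms(1) by auto
    have "\<exists>p. p \<noteq> [] \<and> set p \<subseteq> {..<j} \<and> distinct p \<and> hd p = i \<and> last p = \<pi> j \<and> successively ?adj p"
    proof (cases "i \<le> \<pi> j")
      case True
      from less.IH[OF j(1) this] show ?thesis using j(1) by fastforce
    next
      case False
      then obtain p where p: "p \<noteq> []" "set p \<subseteq> {..i}" "distinct p" "hd p = \<pi> j" "last p = i"
        "successively ?adj p"
        using less.IH[OF j(3), of "\<pi> j"] by auto
      \<comment> \<open>When \<open>\<pi> j < i\<close>, the larger end is \<open>i\<close>, so the
        induction hypothesis yields the path in the opposite direction.\<close>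
      have "successively ?adj (rev p)"
        using p(6) unfolding successively_rev by (rule successively_mono) auto
      then show ?thesis
        using p j(3) by (intro exI[of _ "rev p"]) (auto simp: hd_rev last_rev)
    qed
    then obtain p where p: "p \<noteq> []" "set p \<subseteq> {..<j}" "distinct p" "hd p = i" "last p = \<pi> j"
      "successively ?adj p" by blast
    then show ?thesis
      using j by (intro exI[of _ "p @ [j]"]) (auto simp: successively_append_iff)
  qed
qed

text \<open>Connectedness gives the numbering. An edge that is not a parent edge would close the
  path of parent edges between its ends to a cycle, so acyclicity makes the parent edges exhaust
  \<open>E\<close>.\<close>

lemma tree_ordering:
  assumes "is_tree V E"
  obtains v \<pi> where "bij_betw v {..<card V} V" "\<And>i::nat. 0 < i \<Longrightarrow> \<pi> i < i"
    "bij_betw (\<lambda>i. {v i, v (\<pi> i)}) {1..<card V} E"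
proof -
  let ?n = "card V"
  have fin: "finite V" and E: "\<And>e. e \<in> E \<Longrightarrow> e \<subseteq> V \<and> card e = 2" and con: "connected_graph V E"
    and acyc: "\<And>p. \<not> is_cycle V E p"
    using assms unfolding is_tree_def simple_graph_def by auto
  have "0 < ?n" using con fin by (auto simp: connected_graph_def card_gt_0_iff)
  from connected_graph_ordering[OF con fin this le_refl] obtain v \<pi> where
    v: "inj_on v {..<?n}" "v ` {..<?n} \<subseteq> V"
    and \<pi>: "\<And>i. 0 < i \<Longrightarrow> \<pi> i < i" "\<And>i. i \<in> {1..<?n} \<Longrightarrow> {v i, v (\<pi> i)} \<in> E"
    by blast
  have vV: "v ` {..<?n} = V"
    using v fin by (intro card_subset_eq) (auto simp: card_image)
  let ?e = "\<lambda>i. {v i, v (\<pi> i)}"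
  have "inj_on ?e {1..<?n}"
  proof (rule inj_onI)
    fix i j assume ij: "i \<in> {1..<?n}" "j \<in> {1..<?n}" "?e i = ?e j"
    have lt: "\<pi> i < i" "\<pi> j < j" using ij \<pi>(1) by auto
    have "v ` {i, \<pi> i} = v ` {j, \<pi> j}" using ij(3) by simp
    then have "{i, \<pi> i} = {j, \<pi> j}"
      by (rule inj_on_image_eq_iff[OF v(1), THEN iffD1, rotated 2]) (use ij lt in auto)
    \<comment> \<open>An index is the maximum of the pair formed by it and its parent.\<close>
    then show "i = j" using lt by (auto simp: doubleton_eq_iff)
  qed
  moreover have "?e ` {1..<?n} = E"
  proof
    show "?e ` {1..<?n} \<subseteq> E" using \<pi>(2) by auto
    show "E \<subseteq> ?e ` {1..<?n}"
    proof (rule ccontr)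
      assume "\<not> ?thesis"
      then obtain e where e: "e \<in> E" "e \<notin> ?e ` {1..<?n}" by blast
      then obtain x y where xy: "e = {x, y}" "x \<noteq> y" "x \<in> V" "y \<in> V"
        using E[OF e(1)] by (metis card_2_iff insert_subset)
      then obtain k l where kl: "k < ?n" "x = v k" "l < ?n" "y = v l"
        using vV by blast
      define i j where "i = min k l" and "j = max k l"
      have "k \<noteq> l" using xy kl by auto
      then have ij: "i < j" "j < ?n" "e = {v i, v j}"
        using xy kl by (auto simp: i_def j_def min_def max_def)
      from path_to_index[OF \<pi>(1), of i j] obtain p where p: "p \<noteq> []" "set p \<subseteq> {..j}" "distinct p"
        "hd p = i" "last p = j" "successively (\<lambda>a b. 0 < a \<and> b = \<pi> a \<or> 0 < b \<and> a = \<pi> b) p"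
        using ij(1) by auto
      have sub: "set p \<subseteq> {..<?n}" using p(2) ij(2) by auto
      have edge: "{v a, v b} \<in> ?e ` {1..<?n}"
        if "a \<in> set p" "b \<in> set p" "0 < a \<and> b = \<pi> a \<or> 0 < b \<and> a = \<pi> b" for a b
        using that sub by (auto simp: insert_commute)
      have succ: "successively (\<lambda>a b. {v a, v b} \<in> ?e ` {1..<?n}) p"
        using p(6) by (rule successively_mono) (use edge in auto)
      \<comment> \<open>The ends of the path differ, and a path of just two vertices would make
        \<open>e\<close> a parent edge; so there are at least three vertices, as a cycle
        requires.\<close>
      have "length p \<noteq> 1" using p ij(1) by (auto simp: length_Suc_conv)
      moreover have "length p \<noteq> 2"
      proof
        assume "length p = 2"
        then have "p = [i, j]" using p(4,5) by (auto simp: numeral_2_eq_2 length_Suc_conv)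
        then show False using succ e(2) ij(3) by simp
      qed
      moreover have "length p \<noteq> 0" using p(1) by simp
      ultimately have "3 \<le> length p" by linarith
      moreover have "is_walk V E (map v p)"
        using p(1) sub vV succ \<open>?e ` {1..<?n} \<subseteq> E\<close>
        by (auto simp: is_walk_def successively_map elim!: successively_mono)
      moreover have "distinct (map v p)"
        using p(3) sub v(1) by (simp add: distinct_map inj_on_subset)
      moreover have "{last (map v p), hd (map v p)} \<in> E"
        using p(1,4,5) e(1) ij(3) by (simp add: last_map hd_map insert_commute)
      ultimately show False using acyc[of "map v p"] by (simp add: is_cycle_def)
    qed
  qed
  ultimately show thesis
    using that[of v \<pi>] v(1) vV \<pi>(1) by (simp add: bij_betw_def)
qed

section \<open>Transfer of the labelling to the tree\<close>

theorem theorem3p1: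
  fixes V :: "'a set" and E :: "'a set set"
  assumes "is_tree V E"
  shows "cordial 7 V E"
proof -
  from tree_ordering[OF assms] obtain v \<pi> where v: "bij_betw v {..<card V} V"
    and \<pi>: "\<And>i. 0 < i \<Longrightarrow> \<pi> i < i" and e: "bij_betw (\<lambda>i. {v i, v (\<pi> i)}) {1..<card V} E"
    by blast
  define n where "n = card V"
  \<comment> \<open>A generous number of blocks: only those with index up to \<open>n div 7\<close>
    meet the tree.\<close>
  from block_labeling[OF \<pi>, of "Suc n"] obtain g :: "nat \<Rightarrow> nat" where g: "\<And>i. g i < 7"
    "\<And>m. m \<le> n \<Longrightarrow> inj_on g {7 * m..<7 * m + 7}"
    "\<And>m. m \<le> n \<Longrightarrow> inj_on (\<lambda>i. (g i + g (\<pi> i)) mod 7) {7 * m + 1..<7 * m + 8}"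
    by (auto simp: less_Suc_eq_le)
  \<comment> \<open>Outside \<open>V\<close> the inverse is unspecified, but \<open>f\<close> still
    stays below 7 because \<open>g\<close> does so everywhere.\<close>
  define f where "f = g \<circ> the_inv_into {..<n} v"
  have fv: "f (v i) = g i" if "i < n" for i
    using that v by (simp add: f_def n_def the_inv_into_f_f bij_betw_def)
  \<comment> \<open>Edges are numbered from 0 by shifting with \<open>Suc\<close>, which turns the
    edge blocks into the blocks \<open>7 * m\<close>, ..., \<open>7 * m + 6\<close> expected by
    \<open>block_balanced\<close>.\<close>
  let ?w = "\<lambda>i. (g (Suc i) + g (\<pi> (Suc i))) mod 7"
  have vcount: "vertex_count V f a = card {i. i < n \<and> g i = a}" for a
  proof -
    have "bij_betw v {i. i < n \<and> g i = a} {x \<in> V. f x = a}"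
      using v fv unfolding bij_betw_def n_def[symmetric]
      by (auto simp: inj_on_def)
    from bij_betw_same_card[OF this] show ?thesis
      by (simp add: vertex_count_def)
  qed
  have ecount: "edge_count 7 E f a = card {i. i < n - 1 \<and> ?w i = a}" for a
  proof -
    have ew: "edge_weight 7 f {v i, v (\<pi> i)} = (g i + g (\<pi> i)) mod 7" if "i \<in> {1..<n}" for i
    proof -
      have "\<pi> i < i" "i < n" using that \<pi>[of i] by auto
      moreover from this have "v i \<noteq> v (\<pi> i)"
        using v inj_onD[of v "{..<n}" i "\<pi> i"] by (auto simp: bij_betw_def n_def)
      ultimately show ?thesis
        by (simp add: edge_weight_doubleton fv)
    qed
    have "bij_betw (\<lambda>i. {v (Suc i), v (\<pi> (Suc i))}) {..<n - 1} E"
    proof -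
      have "bij_betw Suc {..<n - 1} {1..<n}"
        by (auto simp: bij_betw_def lessThan_atLeast0)
      from bij_betw_trans[OF this e[folded n_def]] show ?thesis by (simp add: o_def)
    qed
    then have "bij_betw (\<lambda>i. {v (Suc i), v (\<pi> (Suc i))}) {i. i < n - 1 \<and> ?w i = a}
        {x \<in> E. edge_weight 7 f x = a}"
      using ew by (auto simp: bij_betw_def inj_on_def)
    from bij_betw_same_card[OF this] show ?thesis
      by (simp add: edge_count_def)
  qed
  have balanced_v: "vertex_count V f a \<in> {n div 7, n div 7 + 1}" if "a < 7" for a
    unfolding vcount
    by (rule block_balanced) (use g(1,2) that in \<open>auto intro: order_trans[OF _ div_le_dividend]\<close>)
  have balanced_e: "edge_count 7 E f a \<in> {(n - 1) div 7, (n - 1) div 7 + 1}" if "a < 7" for a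
    unfolding ecount
  proof (rule block_balanced)
    fix m assume m: "m \<le> (n - 1) div 7"
    then have "m \<le> n" by linarith
    have "inj_on ((\<lambda>i. (g i + g (\<pi> i)) mod 7) \<circ> Suc) {7 * m..<7 * m + 7}"
      using g(3)[OF \<open>m \<le> n\<close>] by (intro comp_inj_on) (auto simp: image_Suc_atLeastLessThan add.commute)
    then show "inj_on ?w {7 * m..<7 * m + 7}" by (simp add: o_def)
  qed (use that in auto)
  have f: "f x < 7" for x using g(1) by (simp add: f_def)
  have diff: "\<bar>int x - int y\<bar> \<le> 1" if "x \<in> {q, q + 1}" "y \<in> {q, q + 1}" for x y q
    using that by auto
  have "cordial_labeling 7 V E f"
    unfolding cordial_labeling_def
    by (intro conjI ballI allI impI f diff[OF balanced_v balanced_v] diff[OF balanced_e balanced_e])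
  then show ?thesis unfolding cordial_def by blast
qed

end
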